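(* Let $(\Pi_n,X_n)$ be a Nash equilibrium of the reduced game $\overline{G}_n(\mu)$, and let $(\overline{p}^n_q)_{q=1,\dots,n}$, $\overline p^n_q=\overline p^n_q(u_1,\dots,u_{q-1})$, be the corresponding pure strategy of player 2 (the price process), i.e. $X_n(\omega)=\frac{1}{\sqrt n}\sum_{q=1}^n u_q\,\overline p^n_q(u_1,\dots,u_{q-1})$. Then the price process $(\overline{p}_q^n)_{q=1,\dots,n}$ is a martingale under the probability $\lambda_n$ (with respect to the filtration $(\sigma(u_1,\dots,u_{q-1}))_{q=1,\dots,n}$).
   Context: Standing assumptions. (A1) $\mu$ is a probability measure on $[0,1]$, absolutely continuous with respect to Lebesgue measure, with strictly positive $C^1$ density $f_\mu$ on $[0,1]$. (A2) $H:\mathbb{R}\to\mathbb{R}$ is strictly increasing, strictly convex and $C^2$, $H'$ is Lipschitz-continuous, and there are constants $\epsilon,K>0$ with $\epsilon<H'(x)<K$ for all $x\in\mathbb{R}$. Notation. $n\ge 1$; $\Omega_n=\{-1,+1\}^n$, $\omega=(u_1,\dots,u_n)\in\Omega_n$; $\lambda_n$ is the uniform probability on $\Omega_n$; $S_n(\omega)=\frac{1}{\sqrt n}\sum_{q=1}^n u_q$. Reduced game $\overline{G}_n(\mu)$ (trading game in which nature draws $L\sim\mu$, observed only by player 1; at each stage $q$ player 1 chooses $u_q=\pm1$ without observing player 2's actions, and player 2 chooses deterministically a price as a function of past moves of player 1). A strategy of player 1 is identified with a probability $\Pi$ on pairs $(\omega,L)\in\Omega_n\times\mathbb{R}$ whose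 marginal on $L$ is $\mu$. A (pure) strategy of player 2 is a sequence $\overline p=(\overline p_1,\dots,\overline p_n)$ with $\overline p_q:\{-1,+1\}^{q-1}\to\mathbb{R}$; it is identified with the function $X_{n,\overline p}(\omega)=\frac{1}{\sqrt n}\sum_{q=1}^n u_q\,\overline p_q(u_1,\dots,u_{q-1})$ on $\Omega_n$, which determines $\overline p$ uniquely. $\mathbb{X}_n$ denotes the set of all such functions. Payoffs: $g_1(\Pi,X)=E_\Pi[LS_n-X]$ (maximized by player 1) and $g_2(\Pi,X)=E_\Pi[H(LS_n-X)]$ (minimized by player 2). A Nash equilibrium is a pair $(\Pi,X)$ such that $\Pi$ maximizes $g_1(\cdot,X)$ and $X$ minimizes $g_2(\Pi,\cdot)$ over $\mathbb{X}_n$. *)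

theory Defs
  imports "HOL-Probability.Probability"
begin

text \<open>On a closed interval the derivative at the end points is one-sided.\<close>

definition C1_on :: "real set \<Rightarrow> (real \<Rightarrow> real) \<Rightarrow> bool" where
  "C1_on S f \<longleftrightarrow>
     (\<exists>f'. (\<forall>x\<in>S. (f has_real_derivative f' x) (at x within S)) \<and> continuous_on S f')"

definition strictly_convex_on :: "real set \<Rightarrow> (real \<Rightarrow> real) \<Rightarrow> bool" where
  "strictly_convex_on S f \<longleftrightarrow> convex S \<and>
     (\<forall>x\<in>S. \<forall>y\<in>S. \<forall>t. x \<noteq> y \<and> 0 < t \<and> t < 1 \<longrightarrow>
        f ((1 - t) * x + t * y) < (1 - t) * f x + t * f y)"

text \<open>A probability on \<open>[0,1]\<close> is a Borel probability on the reals whose density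
  vanishes outside \<open>[0,1]\<close>; the values of \<open>f\<close> outside \<open>[0,1]\<close> play no role.\<close>

definition admissible_law :: "real measure \<Rightarrow> bool" where
  "admissible_law \<mu> \<longleftrightarrow> prob_space \<mu> \<and>
     (\<exists>f. C1_on {0..1} f \<and> (\<forall>x\<in>{0..1}. 0 < f x) \<and>
          \<mu> = density lborel (\<lambda>x. ennreal (indicator {0..1} x * f x)))"

definition admissible_utility :: "(real \<Rightarrow> real) \<Rightarrow> bool" where
  "admissible_utility H \<longleftrightarrow>
     strict_mono H \<and> strictly_convex_on UNIV H \<and>
     (\<forall>x. H differentiable (at x)) \<and> C1_on UNIV (deriv H) \<and>
     (\<exists>C. C-lipschitz_on UNIV (deriv H)) \<and>
     (\<exists>\<epsilon>>0. \<exists>K>0. \<forall>x. \<epsilon> < deriv H x \<and> deriv H x < K)"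

text \<open>An element \<open>\<omega>\<close> has coordinates \<open>u\<^sub>q = \<omega> q\<close> for \<open>q \<in> {1..n}\<close>;
  the history \<open>(u\<^sub>1, \<dots>, u\<^bsub>q-1\<^esub>)\<close> is \<open>restrict \<omega> {1..<q}\<close>.\<close>

definition Omega :: "nat \<Rightarrow> (nat \<Rightarrow> real) set" where
  "Omega n = {1..n} \<rightarrow>\<^sub>E {-1, 1}"

definition lambda_n :: "nat \<Rightarrow> (nat \<Rightarrow> real) measure" where
  "lambda_n n = uniform_count_measure (Omega n)"

definition S_n :: "nat \<Rightarrow> (nat \<Rightarrow> real) \<Rightarrow> real" where
  "S_n n \<omega> = (1 / sqrt (real n)) * (\<Sum>q=1..n. \<omega> q)"

text \<open>Player 1: joint laws of \<open>(\<omega>, L)\<close> with second marginal \<open>\<mu>\<close>.\<close>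

definition strategies1 ::
    "nat \<Rightarrow> real measure \<Rightarrow> ((nat \<Rightarrow> real) \<times> real) measure set" where
  "strategies1 n \<mu> = {P. prob_space P \<and>
     sets P = sets (count_space (Omega n) \<Otimes>\<^sub>M borel) \<and> distr P borel snd = \<mu>}"

text \<open>Player 2: \<open>p q\<close> is only ever applied to histories of length \<open>q - 1\<close>. The induced
  functions are taken extensional, so that equality means equality on \<open>Omega n\<close>.\<close>

definition X_of :: "nat \<Rightarrow> (nat \<Rightarrow> (nat \<Rightarrow> real) \<Rightarrow> real) \<Rightarrow> (nat \<Rightarrow> real) \<Rightarrow> real" where
  "X_of n p = (\<lambda>\<omega>\<in>Omega n.
     (1 / sqrt (real n)) * (\<Sum>q=1..n. \<omega> q * p q (restrict \<omega> {1..<q})))"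

definition strategies2 :: "nat \<Rightarrow> ((nat \<Rightarrow> real) \<Rightarrow> real) set" where
  "strategies2 n = range (X_of n)"

definition g1 ::
    "nat \<Rightarrow> ((nat \<Rightarrow> real) \<times> real) measure \<Rightarrow> ((nat \<Rightarrow> real) \<Rightarrow> real) \<Rightarrow> real" where
  "g1 n P X = (\<integral>(\<omega>, L). L * S_n n \<omega> - X \<omega> \<partial>P)"

definition g2 ::
    "nat \<Rightarrow> (real \<Rightarrow> real) \<Rightarrow> ((nat \<Rightarrow> real) \<times> real) measure
      \<Rightarrow> ((nat \<Rightarrow> real) \<Rightarrow> real) \<Rightarrow> real" where
  "g2 n H P X = (\<integral>(\<omega>, L). H (L * S_n n \<omega> - X \<omega>) \<partial>P)"

definition nash_equilibrium ::
    "nat \<Rightarrow> (real \<Rightarrow> real) \<Rightarrow> real measure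
      \<Rightarrow> ((nat \<Rightarrow> real) \<times> real) measure \<Rightarrow> ((nat \<Rightarrow> real) \<Rightarrow> real) \<Rightarrow> bool" where
  "nash_equilibrium n H \<mu> P X \<longleftrightarrow>
     P \<in> strategies1 n \<mu> \<and> X \<in> strategies2 n \<and>
     (\<forall>P'\<in>strategies1 n \<mu>. g1 n P' X \<le> g1 n P X) \<and>
     (\<forall>X'\<in>strategies2 n. g2 n H P X \<le> g2 n H P X')"

text \<open>Only \<open>space (F q)\<close> and \<open>sets (F q)\<close> matter for a filtration; the conditional
  expectation of \<open>real_cond_exp\<close> is taken with respect to \<open>M\<close>.\<close>

definition martingale_on ::
    "'a measure \<Rightarrow> nat set \<Rightarrow> (nat \<Rightarrow> 'a measure) \<Rightarrow> (nat \<Rightarrow> 'a \<Rightarrow> real) \<Rightarrow> bool" where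
  "martingale_on M T F Y \<longleftrightarrow> prob_space M \<and>
     (\<forall>q\<in>T. subalgebra M (F q)) \<and>
     (\<forall>q\<in>T. \<forall>r\<in>T. q \<le> r \<longrightarrow> sets (F q) \<subseteq> sets (F r)) \<and>
     (\<forall>q\<in>T. Y q \<in> borel_measurable (F q) \<and> integrable M (Y q)) \<and>
     (\<forall>q\<in>T. \<forall>r\<in>T. q \<le> r \<longrightarrow> (AE \<omega> in M. real_cond_exp M (F q) (Y r) \<omega> = Y q \<omega>))"

text \<open>\<open>\<sigma>(u\<^sub>1, \<dots>, u\<^bsub>q-1\<^esub>)\<close> as the \<open>\<sigma>\<close>-algebra on \<open>Omega n\<close> generated by the history map.\<close>

definition history_algebra :: "nat \<Rightarrow> nat \<Rightarrow> (nat \<Rightarrow> real) measure" where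
  "history_algebra n q =
     vimage_algebra (Omega n) (\<lambda>\<omega>. restrict \<omega> {1..<q}) (\<Pi>\<^sub>M i\<in>{1..<q}. borel)"

end

theory Submission
  imports Defs
begin

text \<open>
  The equilibrium conditions enter through two deviations only, one for each player, and together
  they show that \<open>X\<close> depends on \<open>\<omega>\<close> through \<open>S_n n \<omega>\<close> alone.

  Player 2 forces player 1 to use every path (\<open>best_reply2_imp_full_support\<close>). A function on
  \<open>Omega n\<close> that has mean 0 under \<open>lambda_n n\<close> is the gain of some trading strategy. The function
  equal to \<open>1\<close> off a path \<open>\<omega>0\<close> and to \<open>1 - 2 ^ n\<close> at \<open>\<omega>0\<close> is of this kind. If \<open>\<omega>0\<close> had probability
  0, then adding it to \<open>X\<close> would lower \<open>L S\<^sub>n - X\<close> by 1 almost surely; as \<open>H\<close> is strictly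
  increasing, player 2 would be strictly better off.

  Player 1 chooses, among the paths with a given value of \<open>S\<^sub>n\<close>, only those with the least \<open>X\<close>:
  moving the mass of a path to a path with the same \<open>S\<^sub>n\<close> changes the payoff by the difference of the
  values of \<open>X\<close> (\<open>best_reply1_imp_cheapest\<close>). As all paths have mass, \<open>X\<close> takes equal values on paths
  with equal \<open>S\<^sub>n\<close>. In particular it is invariant under permutations of the coordinates.

  The martingale property follows from this symmetry. The increments \<open>u\<^sub>k p\<^sub>k\<close> are orthogonal under
  \<open>lambda_n n\<close> to \<open>u\<^sub>r\<close> times any function of the history before \<open>r\<close>, unless \<open>k = r\<close>. Hence, for
  \<open>q \<le> r\<close>, the conditional expectation of \<open>p\<^sub>r\<close> given the history before \<open>q\<close> is \<open>sqrt n\<close> times that of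
  \<open>u\<^sub>r X\<close> (\<open>sum_price_eq_sum_covariation\<close>). Exchanging the coordinates \<open>q\<close> and \<open>r\<close> leaves this
  history, the law \<open>lambda_n n\<close> and \<open>X\<close> unchanged and turns \<open>u\<^sub>r X\<close> into \<open>u\<^sub>q X\<close>, whose conditional
  expectation is \<open>p\<^sub>q / sqrt n\<close> (\<open>sum_price_constant\<close>).
\<close>

section \<open>Sign paths and gains from trade\<close>

lemma finite_Omega [simp]: "finite (Omega n)"
  unfolding Omega_def by (intro finite_PiE) auto

lemma Omega_nonempty: "Omega n \<noteq> {}"
  unfolding Omega_def by (simp add: PiE_eq_empty_iff)

lemma Omega_square: "\<omega> \<in> Omega n \<Longrightarrow> i \<in> {1..n} \<Longrightarrow> \<omega> i * \<omega> i = 1"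
  unfolding Omega_def by (auto dest!: PiE_mem)

lemma X_of_add:
  "\<omega> \<in> Omega n \<Longrightarrow> X_of n (\<lambda>q h. p q h + d q h) \<omega> = X_of n p \<omega> + X_of n d \<omega>"
  unfolding X_of_def by (simp add: algebra_simps sum.distrib)

text \<open>The strategy replicates \<open>1\<close> minus the product of the factors \<open>1 + u\<^sub>i \<omega>0\<^sub>i\<close>. This product
  vanishes as soon as \<open>\<omega>\<close> and \<open>\<omega>0\<close> differ in one coordinate, and the increment of its partial products
  at stage \<open>q\<close> is \<open>u\<^sub>q\<close> times a function of the history before \<open>q\<close>.\<close>

lemma one_replicable_off_a_point:
  assumes "n \<ge> 1" and w0: "\<omega>0 \<in> Omega n"
  obtains d where "\<And>\<omega>. \<omega> \<in> Omega n \<Longrightarrow> \<omega> \<noteq> \<omega>0 \<Longrightarrow> X_of n d \<omega> = 1"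
proof -
  define d where "d q h = - sqrt n * \<omega>0 q * (\<Prod>i\<in>{1..<q}. 1 + h i * \<omega>0 i)"
    for q and h :: "nat \<Rightarrow> real"
  have "X_of n d \<omega> = 1" if w: "\<omega> \<in> Omega n" and ne: "\<omega> \<noteq> \<omega>0" for \<omega>
  proof -
    have telescope: "(\<Sum>q=1..m. \<omega> q * \<omega>0 q * (\<Prod>i\<in>{1..<q}. 1 + \<omega> i * \<omega>0 i))
        = (\<Prod>i=1..m. 1 + \<omega> i * \<omega>0 i) - 1" for m
    proof (induction m)
      case (Suc m)
      have "{1..<Suc m} = {1..m}" by auto
      then show ?case using Suc by (simp add: algebra_simps)
    qed simp
    obtain i where i: "i \<in> {1..n}" "\<omega> i \<noteq> \<omega>0 i"
      using w w0 ne unfolding Omega_def by (meson PiE_ext)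
    have "\<omega> i \<in> {-1, 1}" "\<omega>0 i \<in> {-1, 1}"
      using w w0 i(1) unfolding Omega_def by (blast dest: PiE_mem)+
    then have "1 + \<omega> i * \<omega>0 i = 0" using i(2) by auto
    then have zero: "(\<Prod>i=1..n. 1 + \<omega> i * \<omega>0 i) = 0"
      using i(1) by (intro prod_zero) auto
    have "X_of n d \<omega> = (1 / sqrt n) *
        (\<Sum>q=1..n. - sqrt n * (\<omega> q * \<omega>0 q * (\<Prod>i\<in>{1..<q}. 1 + \<omega> i * \<omega>0 i)))"
      using w unfolding X_of_def d_def by (simp add: mult_ac)
    also have "\<dots> = - (\<Sum>q=1..n. \<omega> q * \<omega>0 q * (\<Prod>i\<in>{1..<q}. 1 + \<omega> i * \<omega>0 i))"
      using \<open>n \<ge> 1\<close> by (simp only: sum_distrib_left[symmetric]) (simp add: sum_negf)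
    finally show ?thesis using telescope[of n] zero by simp
  qed
  then show ?thesis by (rule that)
qed

section \<open>Integrability of payoffs\<close>

lemma admissible_law_AE_unit:
  assumes "admissible_law \<mu>"
  shows "AE x in \<mu>. x \<in> {0..1}"
proof -
  obtain f where f: "C1_on {0..1} f"
    and mu: "\<mu> = density lborel (\<lambda>x. ennreal (indicator {0..1} x * f x))"
    using assms unfolding admissible_law_def by blast
  have "continuous_on {0..1} f"
    using f unfolding C1_on_def by (meson DERIV_continuous continuous_on_eq_continuous_within)
  then have "(\<lambda>x. indicator {0..1} x * f x) \<in> borel_measurable borel"
    using borel_measurable_continuous_on_indicator[of "{0..1}" f] by simp
  then show ?thesis
    unfolding mu by (subst AE_density) (auto simp: indicator_def split: if_splits)
qed

lemma strategies1_measurable: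
  assumes "P \<in> strategies1 n \<mu>"
  shows "fst \<in> measurable P (count_space (Omega n))" "snd \<in> borel_measurable P"
    "space P = Omega n \<times> UNIV"
proof -
  have P: "sets P = sets (count_space (Omega n) \<Otimes>\<^sub>M borel)"
    using assms by (auto simp: strategies1_def)
  show "fst \<in> measurable P (count_space (Omega n))" "snd \<in> borel_measurable P"
    by (simp_all add: measurable_cong_sets[OF P refl])
  show "space P = Omega n \<times> UNIV"
    using sets_eq_imp_space_eq[OF P] by (simp add: space_pair_measure)
qed

lemma strategies1_AE_unit:
  assumes "P \<in> strategies1 n \<mu>" "admissible_law \<mu>"
  shows "AE z in P. snd z \<in> {0..1}"
proof -
  have "AE x in distr P borel snd. x \<in> {0..1}"
    using assms admissible_law_AE_unit by (simp add: strategies1_def)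
  then show ?thesis
    using strategies1_measurable(2)[OF assms(1)] by (subst (asm) AE_distr_iff) auto
qed

text \<open>\<open>L\<close> lies in the unit interval and \<open>\<omega>\<close> takes finitely many values, so the argument of \<open>G\<close> is
  almost surely bounded, and a monotone function is bounded on bounded intervals. Both payoffs are
  instances, with the identity for player 1.\<close>

lemma utility_integrable:
  fixes G :: "real \<Rightarrow> real"
  assumes P: "P \<in> strategies1 n \<mu>" and mu: "admissible_law \<mu>" and G: "mono G"
  shows "integrable P (\<lambda>z. G (snd z * S_n n (fst z) - X (fst z)))"
proof -
  interpret prob_space P using P by (simp add: strategies1_def)
  note [measurable] = strategies1_measurable(1,2)[OF P] borel_measurable_mono[OF G]
  define B where "B = (\<Sum>\<omega>\<in>Omega n. \<bar>S_n n \<omega>\<bar> + \<bar>X \<omega>\<bar>)"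
  have bound: "\<bar>G (snd z * S_n n (fst z) - X (fst z))\<bar> \<le> \<bar>G B\<bar> + \<bar>G (- B)\<bar>"
    if z: "z \<in> space P" "snd z \<in> {0..1}" for z
  proof -
    have "fst z \<in> Omega n" using z(1) strategies1_measurable(3)[OF P] by auto
    then have le: "\<bar>S_n n (fst z)\<bar> + \<bar>X (fst z)\<bar> \<le> B"
      unfolding B_def by (intro member_le_sum) auto
    have "\<bar>snd z * S_n n (fst z)\<bar> \<le> 1 * \<bar>S_n n (fst z)\<bar>"
      unfolding abs_mult using z(2) by (intro mult_right_mono) auto
    then have "snd z * S_n n (fst z) - X (fst z) \<le> B" "- B \<le> snd z * S_n n (fst z) - X (fst z)"
      using le by linarith+
    then have "G (snd z * S_n n (fst z) - X (fst z)) \<le> G B"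
      "G (- B) \<le> G (snd z * S_n n (fst z) - X (fst z))"
      by (auto intro: monoD[OF G])
    then show ?thesis by linarith
  qed
  have [measurable]: "(\<lambda>z. S_n n (fst z)) \<in> borel_measurable P"
    "(\<lambda>z. X (fst z)) \<in> borel_measurable P"
    by (rule measurable_compose[OF strategies1_measurable(1)[OF P]]; simp)+
  show ?thesis
  proof (rule integrable_const_bound[where B = "\<bar>G B\<bar> + \<bar>G (- B)\<bar>"])
    show "AE z in P. norm (G (snd z * S_n n (fst z) - X (fst z))) \<le> \<bar>G B\<bar> + \<bar>G (- B)\<bar>"
      using strategies1_AE_unit[OF P mu] AE_space
      by eventually_elim (use bound in auto)
  qed measurable
qed

section \<open>The two equilibrium conditions\<close>

text \<open>Otherwise player 2 could add to \<open>X\<close> a gain equal to 1 on all paths but \<open>\<omega>0\<close>, which almost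
  surely lowers the argument of \<open>H\<close>.\<close>

lemma best_reply2_imp_full_support:
  assumes "n \<ge> 1" and mu: "admissible_law \<mu>" and H: "strict_mono H"
    and P: "P \<in> strategies1 n \<mu>" and X: "X \<in> strategies2 n"
    and best: "\<And>X'. X' \<in> strategies2 n \<Longrightarrow> g2 n H P X \<le> g2 n H P X'"
    and w0: "\<omega>0 \<in> Omega n"
  shows "\<not> (AE z in P. fst z \<noteq> \<omega>0)"
proof
  assume null: "AE z in P. fst z \<noteq> \<omega>0"
  interpret prob_space P using P by (simp add: strategies1_def)
  obtain p where p: "X = X_of n p" using X by (auto simp: strategies2_def)
  obtain d where d: "\<And>\<omega>. \<omega> \<in> Omega n \<Longrightarrow> \<omega> \<noteq> \<omega>0 \<Longrightarrow> X_of n d \<omega> = 1"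
    using one_replicable_off_a_point[OF \<open>n \<ge> 1\<close> w0] by blast
  define X' where "X' = X_of n (\<lambda>q h. p q h + d q h)"
  have lt: "AE z in P. H (snd z * S_n n (fst z) - X' (fst z)) < H (snd z * S_n n (fst z) - X (fst z))"
    using null AE_space
  proof eventually_elim
    case (elim z)
    then have "fst z \<in> Omega n" using strategies1_measurable(3)[OF P] by auto
    then have "X' (fst z) = X (fst z) + 1"
      using elim by (simp add: X'_def p X_of_add d)
    then show ?case by (intro strict_monoD[OF H]) simp
  qed
  have "g2 n H P X' < g2 n H P X"
    unfolding g2_def split_beta
    by (intro integral_less_AE_space utility_integrable[OF P mu] lt strict_mono_mono H)
      (simp add: emeasure_space_1)
  moreover have "g2 n H P X \<le> g2 n H P X'"
    by (rule best) (simp add: strategies2_def X'_def)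
  ultimately show False by simp
qed

text \<open>The deviation sends \<open>(\<omega>, L)\<close> to \<open>(\<omega>', L)\<close> and fixes all other points. It keeps the law of \<open>L\<close>
  and the value of \<open>L S\<^sub>n\<close>, so it must not save anything on \<open>X\<close>.\<close>

lemma best_reply1_imp_cheapest:
  assumes mu: "admissible_law \<mu>" and P: "P \<in> strategies1 n \<mu>"
    and best: "\<And>P'. P' \<in> strategies1 n \<mu> \<Longrightarrow> g1 n P' X \<le> g1 n P X"
    and w: "\<omega> \<in> Omega n" "\<omega>' \<in> Omega n" and S: "S_n n \<omega> = S_n n \<omega>'"
    and mass: "\<not> (AE z in P. fst z \<noteq> \<omega>)"
  shows "X \<omega> \<le> X \<omega>'"
proof (rule ccontr)
  assume "\<not> X \<omega> \<le> X \<omega>'"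
  then have less: "X \<omega>' < X \<omega>" by simp
  interpret prob_space P using P by (simp add: strategies1_def)
  define f where "f v = (if v = \<omega> then \<omega>' else v)" for v
  define T where "T z = (f (fst z), snd z)" for z :: "(nat \<Rightarrow> real) \<times> real"
  define P' where "P' = distr P (count_space (Omega n) \<Otimes>\<^sub>M borel) T"
  note [measurable] = strategies1_measurable(1,2)[OF P]
  have f: "f \<in> measurable (count_space (Omega n)) (count_space (Omega n))"
    using w by (auto simp: f_def)
  have [measurable]: "T \<in> measurable P (count_space (Omega n) \<Otimes>\<^sub>M borel)"
    unfolding T_def
    by (intro measurable_Pair measurable_compose[OF strategies1_measurable(1)[OF P] f]) simp
  have "distr P' borel snd = distr P borel snd"
    unfolding P'_def by (subst distr_distr) (auto simp: T_def comp_def)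
  then have P': "P' \<in> strategies1 n \<mu>"
    using P prob_space_distr[of T] by (simp add: strategies1_def P'_def)
  define old where "old z = snd z * S_n n (fst z) - X (fst z)" for z
  define new where "new z = snd z * S_n n (fst z) - X (f (fst z))" for z
  have int: "integrable P old" "integrable P new"
    unfolding old_def new_def
    using utility_integrable[OF P mu, of "\<lambda>x. x" X] utility_integrable[OF P mu, of "\<lambda>x. x" "X \<circ> f"]
    by (simp_all add: mono_def)
  have Sf: "S_n n (f v) = S_n n v" for v using S by (simp add: f_def)
  have meas: "(\<lambda>z. snd z * S_n n (fst z) - X (fst z))
      \<in> borel_measurable (count_space (Omega n) \<Otimes>\<^sub>M borel)"
  proof -
    have [measurable]: "(\<lambda>z. S_n n (fst z)) \<in> borel_measurable (count_space (Omega n) \<Otimes>\<^sub>M (borel :: real measure))"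
      "(\<lambda>z. X (fst z)) \<in> borel_measurable (count_space (Omega n) \<Otimes>\<^sub>M (borel :: real measure))"
      by (rule measurable_compose[OF measurable_fst]; simp)+
    show ?thesis by measurable
  qed
  have "g1 n P' X = (\<integral>z. new z \<partial>P)"
    unfolding g1_def split_beta P'_def new_def by (subst integral_distr[OF _ meas]) (simp_all add: T_def Sf)
  moreover have "g1 n P X = (\<integral>z. old z \<partial>P)"
    unfolding g1_def split_beta old_def ..
  ultimately have "(\<integral>z. new z - old z \<partial>P) \<le> 0"
    using best[OF P'] int by simp
  moreover have nonneg: "0 \<le> new z - old z" for z
    using less by (simp add: new_def old_def f_def)
  then have "0 \<le> (\<integral>z. new z - old z \<partial>P)" by simp
  ultimately have "(\<integral>z. new z - old z \<partial>P) = 0" by simp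
  then have "AE z in P. new z - old z = 0"
    using int nonneg by (subst (asm) integral_nonneg_eq_0_iff_AE) auto
  then have "AE z in P. fst z \<noteq> \<omega>"
    by (rule AE_mp) (use less in \<open>auto simp: new_def old_def f_def\<close>)
  then show False using mass by simp
qed

section \<open>Prices as covariations\<close>

lemma sum_Omega_odd_eq_0:
  fixes \<phi> :: "(nat \<Rightarrow> real) \<Rightarrow> real"
  assumes "k \<in> {1..n}" and odd: "\<And>\<omega>. \<omega> \<in> Omega n \<Longrightarrow> \<phi> (fun_upd \<omega> k (- \<omega> k)) = - \<phi> \<omega>"
  shows "(\<Sum>\<omega>\<in>Omega n. \<phi> \<omega>) = 0"
proof -
  have mem: "fun_upd \<omega> k (- \<omega> k) \<in> Omega n" if "\<omega> \<in> Omega n" for \<omega>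
    using that assms(1) unfolding Omega_def by (auto simp: PiE_iff extensional_def)
  have "(\<Sum>\<omega>\<in>Omega n. \<phi> \<omega>) = (\<Sum>\<omega>\<in>Omega n. \<phi> (fun_upd \<omega> k (- \<omega> k)))"
    by (rule sum.reindex_bij_witness[where i = "\<lambda>\<omega>. fun_upd \<omega> k (- \<omega> k)" and j = "\<lambda>\<omega>. fun_upd \<omega> k (- \<omega> k)"])
      (auto simp: mem)
  also have "\<dots> = - (\<Sum>\<omega>\<in>Omega n. \<phi> \<omega>)"
    by (simp add: odd sum_negf)
  finally show ?thesis by simp
qed

lemma restrict_flip: "k \<notin> A \<Longrightarrow> restrict (fun_upd \<omega> k x) A = restrict \<omega> A"
  by (auto simp: restrict_def)

text \<open>Under the uniform law on paths, the coefficient of \<open>u\<^sub>r\<close> in the orthogonal expansion of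
  \<open>X_of n p\<close> is \<open>p\<^sub>r / sqrt n\<close>. The factor \<open>c\<close> is an arbitrary test function of the history before \<open>q\<close>.\<close>

lemma sum_price_eq_sum_covariation:
  assumes "n \<ge> 1" and r: "r \<in> {1..n}" and qr: "q \<le> r"
  shows "(\<Sum>\<omega>\<in>Omega n. c (restrict \<omega> {1..<q}) * p r (restrict \<omega> {1..<r}))
    = sqrt n * (\<Sum>\<omega>\<in>Omega n. c (restrict \<omega> {1..<q}) * \<omega> r * X_of n p \<omega>)"
proof -
  define a where "a \<omega> k = c (restrict \<omega> {1..<q}) * \<omega> r * (\<omega> k * p k (restrict \<omega> {1..<k}))" for \<omega> k
  have "sqrt n * (\<Sum>\<omega>\<in>Omega n. c (restrict \<omega> {1..<q}) * \<omega> r * X_of n p \<omega>)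
      = (\<Sum>\<omega>\<in>Omega n. \<Sum>k=1..n. a \<omega> k)"
    using \<open>n \<ge> 1\<close> by (simp add: X_of_def a_def sum_distrib_left)
  also have "\<dots> = (\<Sum>k=1..n. \<Sum>\<omega>\<in>Omega n. a \<omega> k)"
    by (rule sum.swap)
  also have "\<dots> = (\<Sum>k=1..n. if k = r then \<Sum>\<omega>\<in>Omega n. a \<omega> r else 0)"
  proof (rule sum.cong)
    fix k assume k: "k \<in> {1..n}"
    have "(\<Sum>\<omega>\<in>Omega n. a \<omega> k) = 0" if "k \<noteq> r"
      \<comment> \<open>The later of the two signs \<open>\<omega> k\<close> and \<open>\<omega> r\<close> appears in no other factor,
        so flipping it reverses the sign of the summand\<close>
      using k r qr that
      by (intro sum_Omega_odd_eq_0[where k = "max k r"]) (auto simp: a_def restrict_flip max_def)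
    then show "(\<Sum>\<omega>\<in>Omega n. a \<omega> k) = (if k = r then \<Sum>\<omega>\<in>Omega n. a \<omega> r else 0)" by simp
  qed simp
  also have "\<dots> = (\<Sum>\<omega>\<in>Omega n. a \<omega> r)" using r by simp
  also have "\<dots> = (\<Sum>\<omega>\<in>Omega n. c (restrict \<omega> {1..<q}) * p r (restrict \<omega> {1..<r}))"
  proof (rule sum.cong)
    fix \<omega> assume "\<omega> \<in> Omega n"
    have "a \<omega> r = (\<omega> r * \<omega> r) * (c (restrict \<omega> {1..<q}) * p r (restrict \<omega> {1..<r}))"
      by (simp add: a_def mult_ac)
    then show "a \<omega> r = c (restrict \<omega> {1..<q}) * p r (restrict \<omega> {1..<r})"
      using Omega_square[OF \<open>\<omega> \<in> Omega n\<close> r] by simp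
  qed simp
  finally show ?thesis by simp
qed

lemma transpose_Omega:
  assumes "q \<in> {1..n}" "r \<in> {1..n}" "\<omega> \<in> Omega n"
  shows "\<omega> \<circ> Transposition.transpose q r \<in> Omega n"
    and "S_n n (\<omega> \<circ> Transposition.transpose q r) = S_n n \<omega>"
proof -
  show "\<omega> \<circ> Transposition.transpose q r \<in> Omega n"
    using assms unfolding Omega_def
    by (auto simp: PiE_iff extensional_def Transposition.transpose_def)
  have "bij_betw (Transposition.transpose q r) {1..n} {1..n}"
    using assms by simp
  then have "(\<Sum>k=1..n. \<omega> (Transposition.transpose q r k)) = (\<Sum>k=1..n. \<omega> k)"
    by (rule sum.reindex_bij_betw)
  then show "S_n n (\<omega> \<circ> Transposition.transpose q r) = S_n n \<omega>"
    by (simp add: S_n_def)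
qed

text \<open>This is the martingale property tested against functions \<open>c\<close> of the history: after both sides are
  written as covariations with \<open>X_of n p\<close>, the transposition of \<open>q\<close> and \<open>r\<close> maps one to the other.\<close>

lemma sum_price_constant:
  assumes "n \<ge> 1" and q: "q \<in> {1..n}" and r: "r \<in> {1..n}" and qr: "q \<le> r"
    and sym: "\<And>\<omega> \<omega>'. \<omega> \<in> Omega n \<Longrightarrow> \<omega>' \<in> Omega n \<Longrightarrow> S_n n \<omega> = S_n n \<omega>'
      \<Longrightarrow> X_of n p \<omega> = X_of n p \<omega>'"
  shows "(\<Sum>\<omega>\<in>Omega n. c (restrict \<omega> {1..<q}) * p r (restrict \<omega> {1..<r}))
    = (\<Sum>\<omega>\<in>Omega n. c (restrict \<omega> {1..<q}) * p q (restrict \<omega> {1..<q}))"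
proof -
  let ?t = "Transposition.transpose q r"
  have past: "restrict (\<omega> \<circ> ?t) {1..<q} = restrict \<omega> {1..<q}" for \<omega> :: "nat \<Rightarrow> real"
    using qr by (auto simp: restrict_def Transposition.transpose_def)
  have "(\<Sum>\<omega>\<in>Omega n. c (restrict \<omega> {1..<q}) * \<omega> r * X_of n p \<omega>)
      = (\<Sum>\<omega>\<in>Omega n. c (restrict \<omega> {1..<q}) * \<omega> q * X_of n p \<omega>)"
  proof (rule sum.reindex_bij_witness[where i = "\<lambda>\<omega>. \<omega> \<circ> ?t" and j = "\<lambda>\<omega>. \<omega> \<circ> ?t"])
    fix \<omega> assume w: "\<omega> \<in> Omega n"
    show "\<omega> \<circ> ?t \<circ> ?t = \<omega>" "\<omega> \<circ> ?t \<circ> ?t = \<omega>" by (auto simp: comp_def)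
    show "\<omega> \<circ> ?t \<in> Omega n" "\<omega> \<circ> ?t \<in> Omega n" using transpose_Omega(1)[OF q r w] by auto
    have "X_of n p (\<omega> \<circ> ?t) = X_of n p \<omega>"
      by (rule sym) (use transpose_Omega[OF q r w] w in auto)
    then show "c (restrict (\<omega> \<circ> ?t) {1..<q}) * (\<omega> \<circ> ?t) q * X_of n p (\<omega> \<circ> ?t)
        = c (restrict \<omega> {1..<q}) * \<omega> r * X_of n p \<omega>"
      unfolding past by simp
  qed
  then show ?thesis
    using sum_price_eq_sum_covariation[OF \<open>n \<ge> 1\<close> r qr, of c p]
      sum_price_eq_sum_covariation[OF \<open>n \<ge> 1\<close> q order_refl, of c p] by simp
qed

section \<open>The history filtration\<close>

text \<open>Since there are finitely many histories, each a closed point of the product space, every set of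
  histories counts and not only the Borel sets. This makes \<open>p q\<close> adapted although it is an arbitrary
  function.\<close>

lemma sets_history_algebra:
  "sets (history_algebra n q) = {{\<omega> \<in> Omega n. restrict \<omega> {1..<q} \<in> B} | B. True}"
proof -
  let ?M = "\<Pi>\<^sub>M i\<in>{1..<q}. (borel :: real measure)"
  let ?h = "\<lambda>\<omega>::nat \<Rightarrow> real. restrict \<omega> {1..<q}"
  have sets: "sets (history_algebra n q) = {?h -` A \<inter> Omega n | A. A \<in> sets ?M}"
    unfolding history_algebra_def by (rule sets_vimage_algebra2) (auto simp: space_PiM)
  have "B \<inter> ?h ` Omega n \<in> sets ?M" for B
  proof (rule sets.countable)
    fix h assume "h \<in> B \<inter> ?h ` Omega n"
    then have "h \<in> extensional {1..<q}" by auto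
    then have "{h} = (\<Pi>\<^sub>E i\<in>{1..<q}. {h i})" by (simp add: PiE_singleton)
    also have "\<dots> \<in> sets ?M" by (intro sets_PiM_I_finite) auto
    finally show "{h} \<in> sets ?M" .
  next
    show "countable (B \<inter> ?h ` Omega n)" by (intro countable_finite) simp
  qed
  then have "{\<omega> \<in> Omega n. ?h \<omega> \<in> B} \<in> sets (history_algebra n q)" for B
    unfolding sets by (intro CollectI exI[of _ "B \<inter> ?h ` Omega n"]) auto
  moreover have "\<exists>B. A = {\<omega> \<in> Omega n. ?h \<omega> \<in> B}"
    if "A \<in> {?h -` A \<inter> Omega n | A. A \<in> sets ?M}" for A
  proof -
    from that obtain B where "A = ?h -` B \<inter> Omega n" by (elim CollectE exE conjE)
    then show ?thesis by (intro exI[of _ B]) auto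
  qed
  ultimately show ?thesis
    unfolding sets[symmetric] by (intro equalityI subsetI) (simp, elim CollectE exE conjE, simp)
qed

lemma space_history_algebra [simp]: "space (history_algebra n q) = Omega n"
  by (simp add: history_algebra_def)

lemma history_algebra_mono:
  assumes "q \<le> r"
  shows "sets (history_algebra n q) \<subseteq> sets (history_algebra n r)"
proof
  fix A assume "A \<in> sets (history_algebra n q)"
  then obtain B where A: "A = {\<omega> \<in> Omega n. restrict \<omega> {1..<q} \<in> B}"
    by (auto simp: sets_history_algebra)
  have "restrict \<omega> {1..<q} = restrict (restrict \<omega> {1..<r}) {1..<q}" for \<omega> :: "nat \<Rightarrow> real"
    using assms by (auto simp: restrict_def)
  then have "A = {\<omega> \<in> Omega n. restrict \<omega> {1..<r} \<in> {h. restrict h {1..<q} \<in> B}}"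
    unfolding A by auto
  then show "A \<in> sets (history_algebra n r)"
    unfolding sets_history_algebra by blast
qed

lemma measurable_history_algebra:
  fixes g :: "(nat \<Rightarrow> real) \<Rightarrow> real"
  shows "(\<lambda>\<omega>. g (restrict \<omega> {1..<q})) \<in> borel_measurable (history_algebra n q)"
proof (rule measurableI)
  fix A :: "real set"
  show "(\<lambda>\<omega>. g (restrict \<omega> {1..<q})) -` A \<inter> space (history_algebra n q)
      \<in> sets (history_algebra n q)"
    unfolding space_history_algebra sets_history_algebra
    by (intro CollectI exI[of _ "g -` A"]) auto
qed simp

lemma integral_lambda_n: "(\<integral>\<omega>. g \<omega> \<partial>lambda_n n) = (\<Sum>\<omega>\<in>Omega n. g \<omega>) / card (Omega n)"
  for g :: "_ \<Rightarrow> real"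
  unfolding lambda_n_def by (rule integral_uniform_count_measure) simp

section \<open>Equilibrium prices are a martingale\<close>

theorem theorem15:
  fixes n :: nat
    and \<mu> :: "real measure"
    and H :: "real \<Rightarrow> real"
    and P :: "((nat \<Rightarrow> real) \<times> real) measure"
    and X :: "(nat \<Rightarrow> real) \<Rightarrow> real"
    and p :: "nat \<Rightarrow> (nat \<Rightarrow> real) \<Rightarrow> real"
  assumes "n \<ge> 1"
    and "admissible_law \<mu>"
    and "admissible_utility H"
    and "nash_equilibrium n H \<mu> P X"
    and "X = X_of n p"
  shows "martingale_on (lambda_n n) {1..n} (history_algebra n)
           (\<lambda>q \<omega>. p q (restrict \<omega> {1..<q}))"
proof -
  have P: "P \<in> strategies1 n \<mu>" and X: "X \<in> strategies2 n"
    and best1: "\<And>P'. P' \<in> strategies1 n \<mu> \<Longrightarrow> g1 n P' X \<le> g1 n P X"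
    and best2: "\<And>X'. X' \<in> strategies2 n \<Longrightarrow> g2 n H P X \<le> g2 n H P X'"
    using assms(4) by (auto simp: nash_equilibrium_def)
  have H: "strict_mono H" using assms(3) by (simp add: admissible_utility_def)
  have le: "X \<omega> \<le> X \<omega>'"
    if "\<omega> \<in> Omega n" "\<omega>' \<in> Omega n" "S_n n \<omega> = S_n n \<omega>'" for \<omega> \<omega>'
    by (rule best_reply1_imp_cheapest[OF assms(2) P best1 that
          best_reply2_imp_full_support[OF assms(1,2) H P X best2 that(1)]])
  have price_sym: "X_of n p \<omega> = X_of n p \<omega>'"
    if "\<omega> \<in> Omega n" "\<omega>' \<in> Omega n" "S_n n \<omega> = S_n n \<omega>'" for \<omega> \<omega>'
    using le[of \<omega> \<omega>'] le[of \<omega>' \<omega>] that assms(5) by auto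

  let ?M = "lambda_n n" and ?F = "history_algebra n"
  let ?Y = "\<lambda>q \<omega>. p q (restrict \<omega> {1..<q})"
  interpret prob_space ?M
    unfolding lambda_n_def by (intro prob_space_uniform_count_measure Omega_nonempty) simp
  have sub: "subalgebra ?M (?F q)" for q
    by (auto simp: subalgebra_def sets_history_algebra lambda_n_def space_uniform_count_measure
        sets_uniform_count_measure)
  have int: "integrable ?M g" for g :: "_ \<Rightarrow> real"
    unfolding lambda_n_def uniform_count_measure_def by (rule integrable_point_measure_finite) simp
  have "AE \<omega> in ?M. real_cond_exp ?M (?F q) (?Y r) \<omega> = ?Y q \<omega>"
    if q: "q \<in> {1..n}" and r: "r \<in> {1..n}" and qr: "q \<le> r" for q r
  proof -
    interpret sigma_finite_subalgebra ?M "?F q"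
      by (rule finite_measure_subalgebra_is_sigma_finite)
        (simp add: finite_measure_subalgebra_def finite_measure_subalgebra_axioms_def
          sub finite_measure_axioms)
    show ?thesis
    proof (rule real_cond_exp_charact)
      fix A assume "A \<in> sets (?F q)"
      then obtain B where A: "A = {\<omega> \<in> Omega n. restrict \<omega> {1..<q} \<in> B}"
        unfolding sets_history_algebra by (elim CollectE exE conjE)
      have "(\<integral>\<omega>\<in>A. ?Y k \<omega> \<partial>?M)
          = (\<Sum>\<omega>\<in>Omega n. indicator B (restrict \<omega> {1..<q}) * ?Y k \<omega>) / card (Omega n)" for k
        unfolding set_lebesgue_integral_def integral_lambda_n
        by (intro arg_cong2[where f = "(/)"] sum.cong) (auto simp: A indicator_def)
      moreover have "(\<Sum>\<omega>\<in>Omega n. indicator B (restrict \<omega> {1..<q}) * ?Y r \<omega>)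
          = (\<Sum>\<omega>\<in>Omega n. indicator B (restrict \<omega> {1..<q}) * ?Y q \<omega>)"
        by (rule sum_price_constant[OF assms(1) q r qr]) (rule price_sym)
      ultimately show "(\<integral>\<omega>\<in>A. ?Y r \<omega> \<partial>?M) = (\<integral>\<omega>\<in>A. ?Y q \<omega> \<partial>?M)"
        by (simp only:)
    qed (rule int measurable_history_algebra)+
  qed
  then show ?thesis
    unfolding martingale_on_def
    by (intro conjI ballI impI prob_space_axioms sub int history_algebra_mono
        measurable_history_algebra)
qed

end
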